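(* Let $\mathbb{K}$ be a field, $S=\mathbb{K}[x_1,\ldots,x_n]$, and let $m=x_{i_1}\cdots x_{i_s}\in S$ be a square-free monomial with $1\le i_1<\cdots<i_s\le n$. Then (1) $\widehat{\alpha}(\mathrm{sfLex}(m))\leq 1+\frac{s-1}{i_1}$, and (2) $\widehat{\alpha}(\mathrm{sfLex}(m))\geq \begin{cases} 1+\frac{s-1}{i_1}, & \text{if } i_{1}\geq s,\\ 2+\frac{s-i_1-1}{n-s+1}, & \text{if } i_{1}\leq s-1.\end{cases}$ In particular, if $i_{1}\geq s-1$, then $\widehat{\alpha}(\mathrm{sfLex}(m))=1+\frac{s-1}{i_1}$.
   Context: Square-free lex-segment ideal. Let $<_{\mathrm{lex}}$ be the lexicographic monomial order on $S$ induced by $x_1>x_2>\cdots>x_n>1$. For a square-free monomial $m$ of degree $s$ in $S$, $\mathrm{sfLex}(m)$ is the ideal of $S$ generated by all square-free monomials $u$ of degree $s$ in $S$ with $m\le_{\mathrm{lex}}u$. Waldschmidt constant. For a square-free monomial ideal $L\subseteq S$ with minimal primary decomposition $L=P_1\cap\cdots\cap P_t$ (the $P_i$ prime), the $q$-th symbolic power is $L^{(q)}=P_1^q\cap\cdots\cap P_t^q$. Write $\alpha(J)$ for the smallest degree of a generator of a homogeneous ideal $J$. Then $\widehat{\alpha}(L)=\lim_{q\to\infty}\alpha(L^{(q)})/q$. *)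

theory Defs
  imports Complex_Main "HOL-Library.Poly_Mapping" "HOL-Algebra.Ideal_Product"
begin

section \<open>Monomials\<close>

text \<open>
  A monomial is represented by its exponent vector \<open>u :: nat \<Rightarrow>\<^sub>0 nat\<close>, so the variable
  \<open>x\<^sub>j\<close> is \<open>single j 1\<close> and a product of monomials is a sum of exponent vectors.
\<close>

definition mon_deg :: "(nat \<Rightarrow>\<^sub>0 nat) \<Rightarrow> nat"
  where "mon_deg u = (\<Sum>j\<in>Poly_Mapping.keys u. Poly_Mapping.lookup u j)"

definition squarefree_mon :: "(nat \<Rightarrow>\<^sub>0 nat) \<Rightarrow> bool"
  where "squarefree_mon u \<longleftrightarrow> (\<forall>j. Poly_Mapping.lookup u j \<le> 1)"

text \<open>
  The linear order that the library provides on \<open>nat \<Rightarrow>\<^sub>0 nat\<close> compares two exponent vectors at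
  the smallest index where they differ. It is therefore the lexicographic monomial order with
  \<open>x\<^sub>1 > x\<^sub>2 > \<dots>\<close>, and is used as such below.
\<close>

lemma lex_less_iff:
  fixes u v :: "nat \<Rightarrow>\<^sub>0 nat"
  shows "u < v \<longleftrightarrow> (\<exists>k. Poly_Mapping.lookup u k < Poly_Mapping.lookup v k \<and>
                       (\<forall>j<k. Poly_Mapping.lookup u j = Poly_Mapping.lookup v j))"
  by (simp add: less_poly_mapping.rep_eq less_fun_def)


section \<open>The polynomial ring in \<open>x\<^sub>1, \<dots>, x\<^sub>n\<close>\<close>

type_synonym 'a mpolynomial = "(nat \<Rightarrow>\<^sub>0 nat) \<Rightarrow>\<^sub>0 'a"

definition poly_ring :: "nat \<Rightarrow> 'a::field mpolynomial ring"
  where "poly_ring n =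
    \<lparr>carrier = {f. \<forall>u\<in>Poly_Mapping.keys f. Poly_Mapping.keys u \<subseteq> {1..n}},
     mult = (*), one = 1, zero = 0, add = (+)\<rparr>"

lemma poly_ring_cring: "cring (poly_ring n :: 'a::field mpolynomial ring)"
proof (intro cringI abelian_groupI comm_monoidI)
  let ?R = "poly_ring n :: 'a mpolynomial ring"
  fix f g h :: "'a mpolynomial"
  assume f: "f \<in> carrier ?R" and g: "g \<in> carrier ?R"
  show "f \<oplus>\<^bsub>?R\<^esub> g \<in> carrier ?R"
    using f g Poly_Mapping.keys_add[of f g] by (fastforce simp: poly_ring_def)
  have "Poly_Mapping.keys w \<subseteq> {1..n}" if w: "w \<in> Poly_Mapping.keys (f * g)" for w
  proof -
    from w obtain u v where uv: "w = u + v"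
      and "u \<in> Poly_Mapping.keys f" "v \<in> Poly_Mapping.keys g"
      using Poly_Mapping.keys_mult[of f g] by blast
    then have "Poly_Mapping.keys u \<subseteq> {1..n}" "Poly_Mapping.keys v \<subseteq> {1..n}"
      using f g by (simp_all add: poly_ring_def)
    then show ?thesis
      using Poly_Mapping.keys_add[of u v] unfolding uv by blast
  qed
  then show "f \<otimes>\<^bsub>?R\<^esub> g \<in> carrier ?R" by (simp add: poly_ring_def)
next
  fix f :: "'a mpolynomial"
  assume "f \<in> carrier (poly_ring n)"
  then show "\<exists>g\<in>carrier (poly_ring n). g \<oplus>\<^bsub>poly_ring n\<^esub> f = \<zero>\<^bsub>poly_ring n\<^esub>"
    by (intro bexI[of _ "- f"]) (simp_all add: poly_ring_def)
qed (simp_all add: poly_ring_def add_ac mult_ac distrib_left distrib_right)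

text \<open>The zero polynomial is homogeneous of every degree.\<close>

definition homogeneous_poly :: "nat \<Rightarrow> 'a::zero mpolynomial \<Rightarrow> bool"
  where "homogeneous_poly d f \<longleftrightarrow> (\<forall>u\<in>Poly_Mapping.keys f. mon_deg u = d)"


section \<open>Square-free lex-segment ideals\<close>

definition sf_lex :: "nat \<Rightarrow> (nat \<Rightarrow>\<^sub>0 nat) \<Rightarrow> 'a::field mpolynomial set"
  where "sf_lex n m =
    Idl\<^bsub>poly_ring n\<^esub> {Poly_Mapping.single u 1 | u.
      Poly_Mapping.keys u \<subseteq> {1..n} \<and> squarefree_mon u \<and> mon_deg u = mon_deg m \<and> m \<le> u}"


section \<open>Primary decomposition and symbolic powers\<close>

definition ideal_radical :: "('a, 'b) ring_scheme \<Rightarrow> 'a set \<Rightarrow> 'a set"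
  where "ideal_radical R I = {a \<in> carrier R. \<exists>k::nat. a [^]\<^bsub>R\<^esub> k \<in> I}"

definition primary_ideal :: "('a, 'b) ring_scheme \<Rightarrow> 'a set \<Rightarrow> bool"
  where "primary_ideal R Q \<longleftrightarrow> ideal Q R \<and> Q \<noteq> carrier R \<and>
    (\<forall>a\<in>carrier R. \<forall>b\<in>carrier R. a \<otimes>\<^bsub>R\<^esub> b \<in> Q \<longrightarrow> a \<in> Q \<or> b \<in> ideal_radical R Q)"

text \<open>Intersecting with the carrier makes the empty intersection the whole ring.\<close>

definition minimal_primary_decomposition ::
    "('a, 'b) ring_scheme \<Rightarrow> 'a set \<Rightarrow> 'a set set \<Rightarrow> bool"
  where "minimal_primary_decomposition R L \<Q> \<longleftrightarrow>
    finite \<Q> \<and> (\<forall>Q\<in>\<Q>. primary_ideal R Q) \<and>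
    carrier R \<inter> \<Inter>\<Q> = L \<and>
    (\<forall>Q\<in>\<Q>. carrier R \<inter> \<Inter>(\<Q> - {Q}) \<noteq> L) \<and>
    inj_on (ideal_radical R) \<Q>"

text \<open>
  Only meaningful for ideals \<open>L\<close> that have a minimal primary decomposition into prime ideals, such
  as square-free monomial ideals. This decomposition is then unique.
\<close>

definition prime_components :: "('a, 'b) ring_scheme \<Rightarrow> 'a set \<Rightarrow> 'a set set"
  where "prime_components R L =
    (THE \<P>. minimal_primary_decomposition R L \<P> \<and> (\<forall>P\<in>\<P>. primeideal P R))"

definition symbolic_power :: "('a, 'b) ring_scheme \<Rightarrow> 'a set \<Rightarrow> nat \<Rightarrow> 'a set"
  where "symbolic_power R L q =
    carrier R \<inter> (\<Inter>P\<in>prime_components R L. P [^]\<^bsub>ideals_set R\<^esub> q)"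


section \<open>The Waldschmidt constant\<close>

text \<open>
  The smallest degree of a generator of a nonzero homogeneous ideal. The value does not depend on
  the system of nonzero homogeneous generators, so the minimum is taken over all of them.
\<close>

definition alpha :: "nat \<Rightarrow> 'a::field mpolynomial set \<Rightarrow> nat"
  where "alpha n J = (LEAST d. \<exists>G \<subseteq> carrier (poly_ring n).
    (\<forall>g\<in>G. g \<noteq> 0 \<and> (\<exists>e. homogeneous_poly e g)) \<and>
    J = Idl\<^bsub>poly_ring n\<^esub> G \<and> (\<exists>g\<in>G. homogeneous_poly d g))"

definition waldschmidt :: "nat \<Rightarrow> 'a::field mpolynomial set \<Rightarrow> real"
  where "waldschmidt n L =
    lim (\<lambda>q. real (alpha n (symbolic_power (poly_ring n) L q)) / real q)"

end

theory Submission
  imports Defs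
begin

text \<open>
  The Waldschmidt constant of a square-free monomial ideal is the value of a covering problem. Regard
  the supports of the generators as the edges of a hypergraph on \<open>{1..n}\<close>. The prime components are
  the ideals generated by the variables of a minimal vertex cover, and a monomial \<open>x\<^sup>u\<close> lies in the
  \<open>q\<close>-th power of such a prime exactly if the exponents of \<open>u\<close> on the cover add up to at least \<open>q\<close>.
  Hence the \<open>q\<close>-th symbolic power is the monomial ideal of those \<open>u\<close> that put weight at least \<open>q\<close>
  on every cover (\<open>symbolic_power_edge_ideal\<close>), and \<open>\<alpha>\<close> of it is the least total weight of such a
  \<open>u\<close> (\<open>alpha_monomial_ideal\<close>). These least weights are subadditive in \<open>q\<close>, so that the limit exists
  and is the infimum of the quotients (\<open>waldschmidt_edge_ideal_limit\<close>). One vector with large weight on all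
  covers therefore bounds the constant from above, and a linear inequality for all such
  vectors bounds it from below.

  Now let \<open>M\<close> be the support of \<open>m\<close>, with \<open>s\<close> elements and minimum \<open>a = i\<^sub>1\<close>.
  Every \<open>s\<close>-subset of \<open>T = {1..a} \<union> M\<close> is an edge: it either contains an index below \<open>a\<close>, which makes
  it lexicographically larger than \<open>M\<close>, or it is \<open>M\<close>. As \<open>T\<close> has \<open>a + s - 1\<close> elements and a cover
  misses at most \<open>s - 1\<close> of them, every cover contains at least \<open>a\<close> elements of \<open>T\<close>. Weight \<open>1\<close> on \<open>T\<close>
  thus gives the upper bound \<open>(a + s - 1) / a\<close>.

  Two kinds of covers suffice for the lower bounds: the interval \<open>{1..a}\<close>, and the complement of any
  set \<open>E\<close> with fewer than \<open>s\<close> elements. If \<open>s - 1 \<le> a\<close>, then \<open>E\<close> is chosen to consist of the \<open>s - 1\<close>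
  heaviest points of \<open>{1..a}\<close>; it carries at least the fraction \<open>(s - 1) / a\<close> of the weight of that
  interval. If \<open>a \<le> s - 1\<close>, then \<open>E\<close> consists of \<open>{1..a}\<close> and the \<open>s - 1 - a\<close> heaviest points beyond
  \<open>a\<close>, which are compared on average with the remaining \<open>n - s + 1\<close> points. In both cases the
  weight of \<open>E\<close> and the weight at least \<open>q\<close> of its complement add up to the bound. Both cases
  include \<open>a = s - 1\<close>, where the upper bound is attained as well.
\<close>


section \<open>Monomials and monomial ideals\<close>

lemma keys_plus_nat:
  fixes u v :: "'k \<Rightarrow>\<^sub>0 nat"
  shows "Poly_Mapping.keys (u + v) = Poly_Mapping.keys u \<union> Poly_Mapping.keys v"
  by (auto simp: in_keys_iff lookup_add)

lemma plus_minus_monomial: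
  fixes u v :: "'k \<Rightarrow>\<^sub>0 nat"
  assumes "\<And>j. Poly_Mapping.lookup v j \<le> Poly_Mapping.lookup u j"
  shows "u = v + (u - v)"
  using assms by (intro poly_mapping_eqI) (simp add: lookup_add lookup_minus)

lemma mon_deg_eq_sum:
  assumes "Poly_Mapping.keys u \<subseteq> {1..n}"
  shows "mon_deg u = (\<Sum>j=1..n. Poly_Mapping.lookup u j)"
  unfolding mon_deg_def using assms by (intro sum.mono_neutral_left) (auto simp: in_keys_iff)

definition sf_mon :: "nat set \<Rightarrow> (nat \<Rightarrow>\<^sub>0 nat)"
  where "sf_mon e = (\<Sum>j\<in>e. Poly_Mapping.single j 1)"

lemma lookup_sf_mon:
  assumes "finite e"
  shows "Poly_Mapping.lookup (sf_mon e) j = (if j \<in> e then 1 else 0)"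
  using assms by (simp add: sf_mon_def lookup_sum lookup_single when_def)

lemma keys_sf_mon: "finite e \<Longrightarrow> Poly_Mapping.keys (sf_mon e) = e"
  by (auto simp: in_keys_iff lookup_sf_mon split: if_splits)

lemma mon_deg_sf_mon: "finite e \<Longrightarrow> mon_deg (sf_mon e) = card e"
  by (simp add: mon_deg_def keys_sf_mon lookup_sf_mon)

lemma squarefree_sf_mon: "finite e \<Longrightarrow> squarefree_mon (sf_mon e)"
  by (simp add: squarefree_mon_def lookup_sf_mon)

lemma squarefree_eq_sf_mon:
  assumes "squarefree_mon u"
  shows "u = sf_mon (Poly_Mapping.keys u)"
proof (rule poly_mapping_eqI)
  fix j
  have "Poly_Mapping.lookup u j \<le> 1"
    using assms by (simp add: squarefree_mon_def)
  then show "Poly_Mapping.lookup u j = Poly_Mapping.lookup (sf_mon (Poly_Mapping.keys u)) j"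
    by (auto simp: lookup_sf_mon in_keys_iff)
qed

text \<open>
  A square-free monomial divides \<open>u\<close> exactly if its support lies in that of \<open>u\<close>. Ideal membership
  thus depends on supports only, and monomial ideals can be studied through hypergraphs.
\<close>

lemma sf_mon_divides_iff:
  assumes "finite e"
  shows "(\<exists>v. u = sf_mon e + v) \<longleftrightarrow> e \<subseteq> Poly_Mapping.keys u"
proof
  assume "\<exists>v. u = sf_mon e + v"
  then show "e \<subseteq> Poly_Mapping.keys u"
    using assms by (auto simp: keys_plus_nat keys_sf_mon)
next
  assume "e \<subseteq> Poly_Mapping.keys u"
  then have "Poly_Mapping.lookup (sf_mon e) j \<le> Poly_Mapping.lookup u j" for j
    using assms by (auto simp: lookup_sf_mon in_keys_iff Suc_le_eq)
  then show "\<exists>v. u = sf_mon e + v"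
    using plus_minus_monomial by blast
qed

lemma poly_mapping_sum_singles:
  fixes f :: "'b \<Rightarrow>\<^sub>0 'c::comm_monoid_add"
  shows "f = (\<Sum>u\<in>Poly_Mapping.keys f. Poly_Mapping.single u (Poly_Mapping.lookup f u))"
  by (rule poly_mapping_eqI) (auto simp: lookup_sum lookup_single when_def in_keys_iff)

text \<open>
  The last case speaks only of the terms of \<open>f\<close> itself, so that membership of \<open>f\<close> in a monomial ideal can be
  used for each of them.
\<close>

lemma additive_induct_monomials [case_names zero add monomial]:
  fixes f :: "'b \<Rightarrow>\<^sub>0 'c::comm_monoid_add"
  assumes "P 0" and add: "\<And>g h. P g \<Longrightarrow> P h \<Longrightarrow> P (g + h)"
    and mono: "\<And>u. u \<in> Poly_Mapping.keys f \<Longrightarrow> P (Poly_Mapping.single u (Poly_Mapping.lookup f u))"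
  shows "P f"
proof -
  have "P (\<Sum>u\<in>K. Poly_Mapping.single u (Poly_Mapping.lookup f u))"
    if "finite K" "K \<subseteq> Poly_Mapping.keys f" for K
    using that by (induction K) (auto intro: assms)
  then show ?thesis
    using poly_mapping_sum_singles[of f] finite_keys[of f] by (metis subset_refl)
qed

text \<open>
  All ideals below are spans of monomials and are recorded by the set of exponents that occur, in which
  only the exponents supported in \<open>{1..n}\<close> count. With \<open>A = UNIV\<close> this is the whole ring.
\<close>

definition monomial_ideal :: "nat \<Rightarrow> (nat \<Rightarrow>\<^sub>0 nat) set \<Rightarrow> 'a::field mpolynomial set"
  where "monomial_ideal n A =
    {f. \<forall>u\<in>Poly_Mapping.keys f. Poly_Mapping.keys u \<subseteq> {1..n} \<and> u \<in> A}"

definition mult_closed :: "(nat \<Rightarrow>\<^sub>0 nat) set \<Rightarrow> bool"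
  where "mult_closed A \<longleftrightarrow> (\<forall>u\<in>A. \<forall>v. u + v \<in> A)"

lemma poly_ring_simps [simp]:
  "carrier (poly_ring n :: 'a::field mpolynomial ring) = monomial_ideal n UNIV"
  "x \<otimes>\<^bsub>poly_ring n\<^esub> y = x * y" "x \<oplus>\<^bsub>poly_ring n\<^esub> y = x + y"
  "\<one>\<^bsub>poly_ring n\<^esub> = 1" "\<zero>\<^bsub>poly_ring n\<^esub> = 0"
  by (simp_all add: poly_ring_def monomial_ideal_def)

lemma monomial_ideal_add:
  "f \<in> monomial_ideal n A \<Longrightarrow> g \<in> monomial_ideal n A \<Longrightarrow> f + g \<in> monomial_ideal n A"
  using Poly_Mapping.keys_add[of f g] by (fastforce simp: monomial_ideal_def)

lemma monomial_ideal_mult: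
  assumes "f \<in> monomial_ideal n A" "g \<in> monomial_ideal n B"
    and "\<And>u v. u \<in> A \<Longrightarrow> v \<in> B \<Longrightarrow> u + v \<in> C"
  shows "f * g \<in> monomial_ideal n C"
  unfolding monomial_ideal_def
proof (intro CollectI ballI)
  fix w assume "w \<in> Poly_Mapping.keys (f * g)"
  then obtain u v where "w = u + v" "u \<in> Poly_Mapping.keys f" "v \<in> Poly_Mapping.keys g"
    using Poly_Mapping.keys_mult[of f g] by blast
  then show "Poly_Mapping.keys w \<subseteq> {1..n} \<and> w \<in> C"
    using assms by (simp add: monomial_ideal_def keys_plus_nat)
qed

lemma single_in_monomial_ideal_iff:
  "Poly_Mapping.single u c \<in> monomial_ideal n A \<longleftrightarrow>
    c = 0 \<or> (Poly_Mapping.keys u \<subseteq> {1..n} \<and> u \<in> A)"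
  by (auto simp: monomial_ideal_def)

lemma zero_in_monomial_ideal [simp]: "0 \<in> monomial_ideal n A"
  by (simp add: monomial_ideal_def)

lemma uminus_in_monomial_ideal: "f \<in> monomial_ideal n A \<Longrightarrow> - f \<in> monomial_ideal n A"
  by (simp add: monomial_ideal_def)

lemma monomial_ideal_mono: "A \<subseteq> B \<Longrightarrow> monomial_ideal n A \<subseteq> monomial_ideal n B"
  by (auto simp: monomial_ideal_def)

text \<open>
  The closure properties of an ideal in terms of the arithmetic of the type of polynomials, since the
  operations of the ring record are unfolded by the simplifier.
\<close>

lemma ideal_poly_ringD:
  assumes "ideal J (poly_ring n :: 'a::field mpolynomial ring)"
  shows "0 \<in> J" and "f \<in> J \<Longrightarrow> g \<in> J \<Longrightarrow> f + g \<in> J"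
    and "f \<in> J \<Longrightarrow> g \<in> monomial_ideal n UNIV \<Longrightarrow> f * g \<in> J"
  using additive_subgroup.zero_closed[OF ideal.axioms(1)[OF assms]]
    additive_subgroup.a_closed[OF ideal.axioms(1)[OF assms], of f g]
    ideal.I_r_closed[OF assms, of f g] by simp_all

lemma monomial_ideal_cong:
  "(\<And>u. Poly_Mapping.keys u \<subseteq> {1..n} \<Longrightarrow> u \<in> A \<longleftrightarrow> u \<in> B) \<Longrightarrow>
    monomial_ideal n A = monomial_ideal n B"
  by (auto simp: monomial_ideal_def)

lemma a_inv_poly_ring:
  fixes f :: "'a::field mpolynomial"
  assumes "f \<in> monomial_ideal n UNIV"
  shows "\<ominus>\<^bsub>poly_ring n\<^esub> f = - f"
proof -
  interpret cring "poly_ring n :: 'a mpolynomial ring" by (rule poly_ring_cring)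
  show ?thesis
    using assms uminus_in_monomial_ideal[OF assms] by (intro minus_equality) simp_all
qed

lemma ideal_monomial_ideal:
  assumes "mult_closed A"
  shows "ideal (monomial_ideal n A :: 'a::field mpolynomial set) (poly_ring n)"
proof -
  interpret cring "poly_ring n :: 'a mpolynomial ring" by (rule poly_ring_cring)
  have sub: "monomial_ideal n A \<subseteq> (monomial_ideal n UNIV :: 'a mpolynomial set)"
    by (rule monomial_ideal_mono) simp
  show ?thesis
  proof (rule idealI)
    show "ring (poly_ring n :: 'a mpolynomial ring)" by (rule ring_axioms)
    show "subgroup (monomial_ideal n A) (add_monoid (poly_ring n :: 'a mpolynomial ring))"
    proof (rule add.subgroupI)
      show "monomial_ideal n A \<noteq> ({} :: 'a mpolynomial set)"
        using zero_in_monomial_ideal by blast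
    next
      fix f :: "'a mpolynomial"
      assume f: "f \<in> monomial_ideal n A"
      then have "\<ominus>\<^bsub>poly_ring n\<^esub> f = - f"
        using sub by (intro a_inv_poly_ring) auto
      then show "\<ominus>\<^bsub>poly_ring n\<^esub> f \<in> monomial_ideal n A"
        using f by (simp add: uminus_in_monomial_ideal)
    qed (use sub in \<open>auto intro: monomial_ideal_add\<close>)
  next
    fix f g :: "'a mpolynomial"
    assume f: "f \<in> monomial_ideal n A" and g: "g \<in> carrier (poly_ring n)"
    have "f * g \<in> monomial_ideal n A"
      using f g assms by (intro monomial_ideal_mult[of f n A g UNIV]) (auto simp: mult_closed_def)
    then show "f \<otimes>\<^bsub>poly_ring n\<^esub> g \<in> monomial_ideal n A"
      "g \<otimes>\<^bsub>poly_ring n\<^esub> f \<in> monomial_ideal n A"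
      by (simp_all add: mult.commute)
  qed
qed

lemma monomial_ideal_eqI:
  fixes J :: "'a::field mpolynomial set"
  assumes "ideal J (poly_ring n)" and "J \<subseteq> monomial_ideal n A"
    and "\<And>u c. u \<in> A \<Longrightarrow> Poly_Mapping.keys u \<subseteq> {1..n} \<Longrightarrow> c \<noteq> 0 \<Longrightarrow> Poly_Mapping.single u c \<in> J"
  shows "J = monomial_ideal n A"
proof
  show "monomial_ideal n A \<subseteq> J"
  proof
    fix f :: "'a mpolynomial"
    assume f: "f \<in> monomial_ideal n A"
    show "f \<in> J"
    proof (induction f rule: additive_induct_monomials)
      case zero
      show ?case by (rule ideal_poly_ringD(1)[OF assms(1)])
    next
      case (add g h)
      then show ?case by (intro ideal_poly_ringD(2)[OF assms(1)])
    next
      case (monomial u)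
      then show ?case
        using f by (intro assms(3)) (auto simp: monomial_ideal_def in_keys_iff)
    qed
  qed
qed (fact assms(2))

lemma Idl_monomials:
  assumes "\<And>b. b \<in> B \<Longrightarrow> Poly_Mapping.keys b \<subseteq> {1..n}"
  shows "Idl\<^bsub>poly_ring n\<^esub> {Poly_Mapping.single b 1 | b. b \<in> B} =
    (monomial_ideal n {u. \<exists>b\<in>B. \<exists>v. u = b + v} :: 'a::field mpolynomial set)"
    (is "Idl\<^bsub>?R\<^esub> ?G = monomial_ideal n ?A")
proof (rule monomial_ideal_eqI)
  interpret cring "poly_ring n :: 'a mpolynomial ring" by (rule poly_ring_cring)
  have G: "?G \<subseteq> carrier ?R"
    using assms by (auto simp: single_in_monomial_ideal_iff)
  show ideal: "ideal (Idl\<^bsub>?R\<^esub> ?G) ?R"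
    by (rule genideal_ideal[OF G])
  have "mult_closed ?A"
    unfolding mult_closed_def by simp (metis add.assoc)
  moreover have "?G \<subseteq> monomial_ideal n ?A"
    using assms by (auto simp: single_in_monomial_ideal_iff) (metis add.right_neutral)
  ultimately show "Idl\<^bsub>?R\<^esub> ?G \<subseteq> monomial_ideal n ?A"
    by (intro genideal_minimal ideal_monomial_ideal)
  fix u :: "nat \<Rightarrow>\<^sub>0 nat" and c :: 'a
  assume "u \<in> ?A" and u: "Poly_Mapping.keys u \<subseteq> {1..n}"
  then obtain b v where b: "b \<in> B" and uv: "u = b + v" by blast
  have "Poly_Mapping.single b 1 \<in> Idl\<^bsub>?R\<^esub> ?G"
    using genideal_self[OF G] b by blast
  moreover have "Poly_Mapping.single v c \<in> carrier ?R"
    using u by (auto simp: single_in_monomial_ideal_iff uv keys_plus_nat)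
  ultimately have "Poly_Mapping.single b 1 * Poly_Mapping.single v c \<in> Idl\<^bsub>?R\<^esub> ?G"
    using ideal_poly_ringD(3)[OF ideal] by simp
  then show "Poly_Mapping.single u c \<in> Idl\<^bsub>?R\<^esub> ?G"
    by (simp add: mult_single uv)
qed

text \<open>
  A homogeneous element of a monomial ideal has the degree of one of its terms, and each term
  lies in the ideal; conversely the monomials of the ideal form a homogeneous generating system.
\<close>

lemma alpha_monomial_ideal:
  assumes "mult_closed A"
  shows "alpha n (monomial_ideal n A :: 'a::field mpolynomial set) =
    (LEAST d. \<exists>u\<in>A. Poly_Mapping.keys u \<subseteq> {1..n} \<and> mon_deg u = d)"
proof -
  let ?R = "poly_ring n :: 'a mpolynomial ring"
  let ?J = "monomial_ideal n A :: 'a mpolynomial set"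
  let ?B = "{u \<in> A. Poly_Mapping.keys u \<subseteq> {1..n}}"
  let ?gen = "\<lambda>d. \<exists>G \<subseteq> carrier ?R. (\<forall>g\<in>G. g \<noteq> 0 \<and> (\<exists>e. homogeneous_poly e g)) \<and>
    ?J = Idl\<^bsub>?R\<^esub> G \<and> (\<exists>g\<in>G. homogeneous_poly d g)"
  interpret cring ?R by (rule poly_ring_cring)
  have "?gen d \<longleftrightarrow> (\<exists>u\<in>A. Poly_Mapping.keys u \<subseteq> {1..n} \<and> mon_deg u = d)" for d
  proof
    assume "?gen d"
    then obtain G g where G: "G \<subseteq> carrier ?R" "?J = Idl\<^bsub>?R\<^esub> G" and "g \<in> G"
      and hom: "homogeneous_poly d g" and "g \<noteq> 0" by blast
    then have "g \<in> ?J" using genideal_self by blast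
    moreover obtain u where "u \<in> Poly_Mapping.keys g"
      using \<open>g \<noteq> 0\<close> by (metis keys_eq_empty ex_in_conv)
    ultimately show "\<exists>u\<in>A. Poly_Mapping.keys u \<subseteq> {1..n} \<and> mon_deg u = d"
      using hom by (auto simp: monomial_ideal_def homogeneous_poly_def)
  next
    assume "\<exists>u\<in>A. Poly_Mapping.keys u \<subseteq> {1..n} \<and> mon_deg u = d"
    then obtain u where u: "u \<in> ?B" "mon_deg u = d" by blast
    let ?G = "{Poly_Mapping.single b (1::'a) | b. b \<in> ?B}"
    have 1: "?G \<subseteq> carrier ?R"
      by (auto simp: single_in_monomial_ideal_iff)
    have 2: "g \<noteq> 0 \<and> (\<exists>e. homogeneous_poly e g)" if "g \<in> ?G" for g
    proof -
      from that obtain b where "g = Poly_Mapping.single b 1" by blast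
      then show ?thesis
        by (auto simp: homogeneous_poly_def simp flip: keys_eq_empty)
    qed
    have 3: "?J = Idl\<^bsub>?R\<^esub> ?G"
    proof -
      have "Idl\<^bsub>?R\<^esub> ?G = monomial_ideal n {u. \<exists>b\<in>?B. \<exists>v. u = b + v}"
        by (rule Idl_monomials) simp
      also have "\<dots> = ?J"
      proof (intro monomial_ideal_cong)
        fix u :: "nat \<Rightarrow>\<^sub>0 nat"
        assume u: "Poly_Mapping.keys u \<subseteq> {1..n}"
        show "u \<in> {u. \<exists>b\<in>?B. \<exists>v. u = b + v} \<longleftrightarrow> u \<in> A"
        proof
          assume "u \<in> A"
          then show "u \<in> {u. \<exists>b\<in>?B. \<exists>v. u = b + v}"
            using u by (intro CollectI bexI[of _ u] exI[of _ 0]) simp_all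
        qed (use assms in \<open>auto simp: mult_closed_def\<close>)
      qed
      finally show ?thesis by simp
    qed
    have 4: "\<exists>g\<in>?G. homogeneous_poly d g"
      using u by (intro bexI[of _ "Poly_Mapping.single u 1"]) (auto simp: homogeneous_poly_def)
    show "?gen d"
      by (intro exI[of _ ?G] conjI ballI 1 2 3 4)
  qed
  then show ?thesis by (simp add: alpha_def)
qed


section \<open>Prime ideals generated by variables and their powers\<close>

definition var_ideal :: "nat \<Rightarrow> nat set \<Rightarrow> 'a::field mpolynomial set"
  where "var_ideal n C = monomial_ideal n {u. Poly_Mapping.keys u \<inter> C \<noteq> {}}"

lemma mult_closed_meets: "mult_closed {u. Poly_Mapping.keys u \<inter> C \<noteq> {}}"
  by (auto simp: mult_closed_def keys_plus_nat)

lemma mult_closed_weight: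
  "mult_closed {u. \<forall>C\<in>\<C>. q \<le> (\<Sum>j\<in>C. Poly_Mapping.lookup u j)}"
  by (auto simp: mult_closed_def lookup_add sum.distrib intro: trans_le_add1)

text \<open>
  The quotient by the ideal generated by the variables from \<open>C\<close> is the polynomial ring in the other
  variables, a domain. To avoid the quotient, each polynomial is split
  into a part free of \<open>C\<close> and a part in the ideal: the product of the \<open>C\<close>-free parts is \<open>C\<close>-free and,
  modulo the ideal, equal to the product of the polynomials, so it vanishes if that product
  lies in the ideal.
\<close>

lemma primeideal_var_ideal:
  "primeideal (var_ideal n C :: 'a::field mpolynomial set) (poly_ring n)"
proof -
  let ?R = "poly_ring n :: 'a mpolynomial ring"
  let ?P = "var_ideal n C :: 'a mpolynomial set"
  interpret cring ?R by (rule poly_ring_cring)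
  have P: "ideal ?P ?R"
    unfolding var_ideal_def by (rule ideal_monomial_ideal[OF mult_closed_meets])
  let ?N = "monomial_ideal n {u. Poly_Mapping.keys u \<inter> C = {}} :: 'a mpolynomial set"
  have split: "\<exists>g\<in>?N. \<exists>h\<in>?P. f = g + h" if f: "f \<in> carrier ?R" for f
  proof (induction f rule: additive_induct_monomials)
    case zero
    have "(0::'a mpolynomial) = 0 + 0" by simp
    then show ?case using ideal_poly_ringD(1)[OF P] by (metis zero_in_monomial_ideal)
  next
    case (add f1 f2)
    then obtain g1 h1 g2 h2 where gh: "g1 \<in> ?N" "h1 \<in> ?P" "f1 = g1 + h1"
      "g2 \<in> ?N" "h2 \<in> ?P" "f2 = g2 + h2" by blast
    have "f1 + f2 = (g1 + g2) + (h1 + h2)" by (simp add: gh algebra_simps)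
    moreover have "h1 + h2 \<in> ?P" using ideal_poly_ringD(2)[OF P] gh by blast
    ultimately show ?case using monomial_ideal_add gh by metis
  next
    case (monomial u)
    let ?s = "Poly_Mapping.single u (Poly_Mapping.lookup f u)"
    have u: "Poly_Mapping.keys u \<subseteq> {1..n}"
      using f monomial by (auto simp: monomial_ideal_def)
    show ?case
    proof (cases "Poly_Mapping.keys u \<inter> C = {}")
      case True
      then have "?s \<in> ?N" using u by (simp add: single_in_monomial_ideal_iff)
      moreover have "(0::'a mpolynomial) \<in> ?P" by (simp add: var_ideal_def)
      ultimately show ?thesis by (metis add.right_neutral)
    next
      case False
      then have "?s \<in> ?P" using u by (simp add: single_in_monomial_ideal_iff var_ideal_def)
      then show ?thesis by (metis add.left_neutral zero_in_monomial_ideal)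
    qed
  qed
  have NP: "f = 0" if "f \<in> ?N" "f \<in> ?P" for f
    using that by (metis (mono_tags, lifting) keys_eq_empty ex_in_conv mem_Collect_eq
        monomial_ideal_def var_ideal_def)
  show ?thesis
  proof (rule primeidealI)
    show "ideal ?P ?R" by (rule P)
    show "cring ?R" by (rule is_cring)
    have "(1::'a mpolynomial) \<notin> ?P"
      by (simp add: var_ideal_def monomial_ideal_def)
    moreover have "(1::'a mpolynomial) \<in> carrier ?R"
      using one_closed by simp
    ultimately show "carrier ?R \<noteq> ?P" by blast
    fix f f'
    assume f: "f \<in> carrier ?R" and f': "f' \<in> carrier ?R" and "f \<otimes>\<^bsub>?R\<^esub> f' \<in> ?P"
    then have ff': "f * f' \<in> ?P" by simp
    obtain g h where gh: "g \<in> ?N" "h \<in> ?P" "f = g + h" using split[OF f] by blast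
    obtain g' h' where gh': "g' \<in> ?N" "h' \<in> ?P" "f' = g' + h'" using split[OF f'] by blast
    have N: "g * g' \<in> ?N"
      using gh gh' by (intro monomial_ideal_mult[of g n _ g']) (auto simp: keys_plus_nat)
    have g: "g \<in> carrier ?R"
      using gh(1) by (auto simp: monomial_ideal_def)
    have "g * h' + h * f' \<in> ?P"
      using ideal_poly_ringD(3)[OF P gh'(2)] ideal_poly_ringD(3)[OF P gh(2)] f' g
      by (intro ideal_poly_ringD(2)[OF P]) (simp_all add: mult.commute)
    then have "- (g * h' + h * f') \<in> ?P"
      unfolding var_ideal_def by (rule uminus_in_monomial_ideal)
    then have "f * f' + - (g * h' + h * f') \<in> ?P"
      by (rule ideal_poly_ringD(2)[OF P ff'])
    also have "f * f' + - (g * h' + h * f') = g * g'"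
      by (simp add: gh gh' algebra_simps)
    finally have "g * g' = 0" using NP N by blast
    then have "g = 0 \<or> g' = 0" by simp
    then show "f \<in> ?P \<or> f' \<in> ?P" using gh gh' by auto
  qed
qed

text \<open>
  In the induction step a monomial of weight at least \<open>q + 1\<close> on \<open>C\<close> contains some variable \<open>x\<^sub>j\<close> with
  \<open>j \<in> C\<close>, and splitting off \<open>x\<^sub>j\<close> lowers the weight by exactly one.
\<close>

lemma var_ideal_power:
  assumes "finite C"
  shows "var_ideal n C [^]\<^bsub>ideals_set (poly_ring n)\<^esub> q =
    (monomial_ideal n {u. q \<le> (\<Sum>j\<in>C. Poly_Mapping.lookup u j)} :: 'a::field mpolynomial set)"
proof (induction q)
  case 0
  show ?case by (simp add: ideals_set_def nat_pow_def)
next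
  case (Suc q)
  let ?R = "poly_ring n :: 'a mpolynomial ring"
  let ?P = "var_ideal n C :: 'a mpolynomial set"
  let ?W = "\<lambda>q. {u. q \<le> (\<Sum>j\<in>C. Poly_Mapping.lookup u j)} :: (nat \<Rightarrow>\<^sub>0 nat) set"
  let ?M = "\<lambda>q. monomial_ideal n (?W q) :: 'a mpolynomial set"
  interpret cring ?R by (rule poly_ring_cring)
  have P: "ideal ?P ?R" 
    unfolding var_ideal_def by (rule ideal_monomial_ideal[OF mult_closed_meets])
  have M: "ideal (?M q) ?R" for q
    using mult_closed_weight[of "{C}" q] by (intro ideal_monomial_ideal) simp
  have "ideal_prod ?R (?M q) ?P = ?M (Suc q)"
  proof (rule monomial_ideal_eqI)
    show "ideal (ideal_prod ?R (?M q) ?P) ?R"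
      by (rule ideal_prod_is_ideal[OF M P])
    show "ideal_prod ?R (?M q) ?P \<subseteq> ?M (Suc q)"
    proof
      fix f assume "f \<in> ideal_prod ?R (?M q) ?P"
      then show "f \<in> ?M (Suc q)"
      proof (induction rule: ideal_prod.induct)
        case (prod g h)
        have "u + v \<in> ?W (Suc q)"
          if "u \<in> ?W q" "v \<in> {u. Poly_Mapping.keys u \<inter> C \<noteq> {}}" for u v
        proof -
          from that(2) obtain j where j: "j \<in> C" "j \<in> Poly_Mapping.keys v" by blast
          then have "1 \<le> Poly_Mapping.lookup v j" by (simp add: in_keys_iff Suc_le_eq)
          also have "\<dots> \<le> (\<Sum>j\<in>C. Poly_Mapping.lookup v j)"
            using assms j by (intro member_le_sum) auto
          finally show ?thesis using that(1) by (simp add: lookup_add sum.distrib)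
        qed
        with prod have "g * h \<in> ?M (Suc q)"
          unfolding var_ideal_def by (blast intro: monomial_ideal_mult)
        then show ?case by simp
      next
        case (sum g h)
        then show ?case by (simp add: monomial_ideal_add)
      qed
    qed
    fix u :: "nat \<Rightarrow>\<^sub>0 nat" and c :: 'a
    assume u: "u \<in> ?W (Suc q)" and ku: "Poly_Mapping.keys u \<subseteq> {1..n}"
    then have "(\<Sum>j\<in>C. Poly_Mapping.lookup u j) \<noteq> 0" by simp
    then obtain j where j: "j \<in> C" "Poly_Mapping.lookup u j \<noteq> 0"
      using sum.not_neutral_contains_not_neutral by blast
    let ?x = "Poly_Mapping.single j (1::nat)"
    have ux: "u = ?x + (u - ?x)"
      using j by (intro plus_minus_monomial) (auto simp: lookup_single when_def)
    have "(\<Sum>k\<in>C. Poly_Mapping.lookup u k) = 1 + (\<Sum>k\<in>C. Poly_Mapping.lookup (u - ?x) k)"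
      using assms j by (subst ux) (simp add: lookup_add sum.distrib lookup_single when_def)
    then have "u - ?x \<in> ?W q" using u by simp
    moreover have k: "Poly_Mapping.keys u = insert j (Poly_Mapping.keys (u - ?x))"
      by (subst ux) (simp add: keys_plus_nat)
    ultimately have "Poly_Mapping.single (u - ?x) c \<in> ?M q"
      using ku by (simp add: single_in_monomial_ideal_iff)
    moreover have "Poly_Mapping.single ?x 1 \<in> ?P"
      using j ku k by (simp add: single_in_monomial_ideal_iff var_ideal_def)
    ultimately have "Poly_Mapping.single (u - ?x) c * Poly_Mapping.single ?x 1
        \<in> ideal_prod ?R (?M q) ?P"
      using ideal_prod.prod[of _ _ _ _ ?R] by fastforce
    also have "Poly_Mapping.single (u - ?x) c * Poly_Mapping.single ?x 1 = Poly_Mapping.single u c"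
      using ux by (simp add: mult_single add.commute)
    finally show "Poly_Mapping.single u c \<in> ideal_prod ?R (?M q) ?P" .
  qed
  then show ?case using Suc by (simp add: ideals_set_def nat_pow_def)
qed


section \<open>Recognising the prime components\<close>

text \<open>
  If some \<open>a \<in> I\<close> is outside \<open>P\<close>, then multiplication by \<open>a\<close> moves the intersection of the other ideals into
  the whole intersection and hence into \<open>P\<close>; by primality these others already intersect inside \<open>P\<close>.
\<close>

lemma (in cring) prime_contains_intersectand:
  assumes P: "primeideal P R" and "finite \<Q>" and "\<And>Q. Q \<in> \<Q> \<Longrightarrow> ideal Q R"
    and "carrier R \<inter> \<Inter>\<Q> \<subseteq> P"
  shows "\<exists>Q\<in>\<Q>. Q \<subseteq> P"
  using assms(2-)
proof (induction \<Q>)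
  case empty
  then have "P = carrier R"
    using ideal.Icarr[OF primeideal.axioms(1)[OF P]] by auto
  then show ?case
    using primeideal.I_notcarr[OF P] by simp
next
  case (insert I \<Q>)
  show ?case
  proof (cases "I \<subseteq> P")
    case False
    then obtain a where a: "a \<in> I" "a \<notin> P" by blast
    have I: "ideal I R" using insert.prems(1) by simp
    have "x \<in> P" if x: "x \<in> carrier R" "x \<in> \<Inter>\<Q>" for x
    proof -
      have acarr: "a \<in> carrier R" using ideal.Icarr[OF I a(1)] .
      have "a \<otimes> x \<in> I" using ideal.I_r_closed[OF I a(1) x(1)] .
      moreover have "a \<otimes> x \<in> Q" if "Q \<in> \<Q>" for Q
        using ideal.I_l_closed[of Q R x a] insert.prems(1) that x acarr by blast
      ultimately have "a \<otimes> x \<in> P"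
        using insert.prems(2) acarr x by blast
      then show ?thesis
        using primeideal.I_prime[OF P acarr x(1)] a(2) by blast
    qed
    then have "\<exists>Q\<in>\<Q>. Q \<subseteq> P"
      using insert.prems(1) by (intro insert.IH) auto
    then show ?thesis by blast
  qed blast
qed

text \<open>
  Uniqueness of an irredundant intersection of primes: each \<open>P\<close> contains some \<open>Q\<close>, which in turn contains some
  \<open>P'\<close> from the first decomposition. Irredundancy forces \<open>P' = P\<close>, so the chain collapses.
\<close>

lemma (in cring) prime_decomposition_subset:
  assumes \<P>: "minimal_primary_decomposition R L \<P>" "\<And>P. P \<in> \<P> \<Longrightarrow> primeideal P R"
    and \<Q>: "minimal_primary_decomposition R L \<Q>" "\<And>Q. Q \<in> \<Q> \<Longrightarrow> primeideal Q R"
  shows "\<P> \<subseteq> \<Q>"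
proof
  fix P assume P: "P \<in> \<P>"
  have fin: "finite \<P>" "finite \<Q>" and int: "carrier R \<inter> \<Inter>\<P> = L" "carrier R \<inter> \<Inter>\<Q> = L"
    and irr: "carrier R \<inter> \<Inter>(\<P> - {P}) \<noteq> L"
    using \<P>(1) \<Q>(1) P by (auto simp: minimal_primary_decomposition_def)
  have "carrier R \<inter> \<Inter>\<Q> \<subseteq> P" using int P by blast
  then obtain Q where Q: "Q \<in> \<Q>" "Q \<subseteq> P"
    using prime_contains_intersectand[OF \<P>(2)[OF P] fin(2)] \<Q>(2) primeideal.axioms(1) by blast
  have "carrier R \<inter> \<Inter>\<P> \<subseteq> Q" using int Q by blast
  then obtain P' where P': "P' \<in> \<P>" "P' \<subseteq> Q"
    using prime_contains_intersectand[OF \<Q>(2)[OF Q(1)] fin(1)] \<P>(2) primeideal.axioms(1) by blast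
  have "P' = P"
  proof (rule ccontr)
    assume "P' \<noteq> P"
    then have "carrier R \<inter> \<Inter>(\<P> - {P}) = carrier R \<inter> \<Inter>\<P>"
      using P P' Q by blast
    then show False using irr int by simp
  qed
  then have "P = Q" using P' Q by blast
  then show "P \<in> \<Q>" using Q by blast
qed

lemma (in cring) ideal_radical_prime:
  assumes "primeideal P R"
  shows "ideal_radical R P = P"
proof
  interpret primeideal P R by (fact assms)
  have "a \<in> P" if "a \<in> carrier R" "a [^] k \<in> P" for a and k :: nat
    using that(2)
  proof (induction k)
    case 0
    then show ?case using one_imp_carrier I_notcarr by simp
  next
    case (Suc k)
    then show ?case using I_prime[of "a [^] k" a] that(1) by auto
  qed
  then show "ideal_radical R P \<subseteq> P" by (auto simp: ideal_radical_def)
  have "a \<in> ideal_radical R P" if "a \<in> P" for a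
    using that Icarr[OF that] by (auto simp: ideal_radical_def intro!: exI[of _ "1::nat"])
  then show "P \<subseteq> ideal_radical R P" by blast
qed

lemma (in cring) prime_components_eqI:
  assumes "finite \<P>" and prime: "\<And>P. P \<in> \<P> \<Longrightarrow> primeideal P R"
    and "carrier R \<inter> \<Inter>\<P> = L" and "\<And>P. P \<in> \<P> \<Longrightarrow> carrier R \<inter> \<Inter>(\<P> - {P}) \<noteq> L"
  shows "prime_components R L = \<P>"
proof -
  have "primary_ideal R P" if "P \<in> \<P>" for P
  proof -
    interpret P: primeideal P R by (rule prime[OF that])
    show ?thesis
      using P.I_prime P.I_notcarr P.is_ideal ideal_radical_prime[OF prime[OF that]]
      by (auto simp: primary_ideal_def)
  qed
  moreover have "inj_on (ideal_radical R) \<P>"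
    using ideal_radical_prime prime by (simp add: inj_on_def)
  ultimately have dec: "minimal_primary_decomposition R L \<P>"
    using assms by (simp add: minimal_primary_decomposition_def)
  show ?thesis
    unfolding prime_components_def
  proof (rule the_equality)
    show "minimal_primary_decomposition R L \<P> \<and> (\<forall>P\<in>\<P>. primeideal P R)"
      using dec prime by blast
    fix \<Q>
    assume "minimal_primary_decomposition R L \<Q> \<and> (\<forall>P\<in>\<Q>. primeideal P R)"
    then show "\<Q> = \<P>"
      using dec prime prime_decomposition_subset[of L] by (metis subset_antisym)
  qed
qed


section \<open>Symbolic powers of square-free monomial ideals\<close>

definition covers :: "nat \<Rightarrow> nat set set \<Rightarrow> nat set set"
  where "covers n H = {C. C \<subseteq> {1..n} \<and> (\<forall>e\<in>H. e \<inter> C \<noteq> {})}"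

definition min_covers :: "nat \<Rightarrow> nat set set \<Rightarrow> nat set set"
  where "min_covers n H = {C \<in> covers n H. \<forall>D\<in>covers n H. D \<subseteq> C \<longrightarrow> D = C}"

text \<open>
  The square-free monomial ideal whose generators have the edges of \<open>H\<close> as supports. Edges may
  contain each other, so the generators need not be minimal.
\<close>

definition edge_ideal :: "nat \<Rightarrow> nat set set \<Rightarrow> 'a::field mpolynomial set"
  where "edge_ideal n H = monomial_ideal n {u. \<exists>e\<in>H. e \<subseteq> Poly_Mapping.keys u}"

lemma finite_covers: "finite (covers n H)"
  by (rule finite_subset[of _ "Pow {1..n}"]) (auto simp: covers_def)

lemma cover_contains_min_cover:
  assumes "C \<in> covers n H"
  obtains D where "D \<in> min_covers n H" "D \<subseteq> C"
  using finite_has_minimal2[OF finite_covers assms] that by (auto simp: min_covers_def)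

lemma monomial_ideal_INT:
  "carrier (poly_ring n) \<inter> (\<Inter>i\<in>I. monomial_ideal n (B i)) =
    (monomial_ideal n (\<Inter>i\<in>I. B i) :: 'a::field mpolynomial set)"
  by (auto simp: monomial_ideal_def)

text \<open>
  A set without an edge has a complement that is a cover, and this cover contains a minimal one.
\<close>

lemma contains_edge_iff_meets_min_covers:
  assumes "H \<subseteq> Pow {1..n}" and "K \<subseteq> {1..n}"
  shows "(\<exists>e\<in>H. e \<subseteq> K) \<longleftrightarrow> (\<forall>C\<in>min_covers n H. K \<inter> C \<noteq> {})"
proof
  assume "\<exists>e\<in>H. e \<subseteq> K"
  then show "\<forall>C\<in>min_covers n H. K \<inter> C \<noteq> {}"
    by (fastforce simp: min_covers_def covers_def)
next
  assume meets: "\<forall>C\<in>min_covers n H. K \<inter> C \<noteq> {}"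
  show "\<exists>e\<in>H. e \<subseteq> K"
  proof (rule ccontr)
    assume "\<not> (\<exists>e\<in>H. e \<subseteq> K)"
    then have "{1..n} - K \<in> covers n H"
      using assms by (fastforce simp: covers_def)
    then show False
      using meets by (metis Diff_disjoint disjoint_iff subsetD cover_contains_min_cover)
  qed
qed

lemma edge_ideal_decomposition:
  assumes "H \<subseteq> Pow {1..n}"
  shows "carrier (poly_ring n) \<inter> \<Inter>(var_ideal n ` min_covers n H) =
    (edge_ideal n H :: 'a::field mpolynomial set)"
  unfolding var_ideal_def monomial_ideal_INT edge_ideal_def
  using contains_edge_iff_meets_min_covers[OF assms]
  by (intro monomial_ideal_cong) simp

text \<open>
  The square-free monomial with support \<open>{1..n} - C\<close> witnesses irredundancy: it avoids the prime of \<open>C\<close>,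
  but lies in the prime of every other minimal cover, because none of these is a subset of \<open>C\<close>.
\<close>

lemma prime_components_edge_ideal:
  assumes H: "H \<subseteq> Pow {1..n}"
  shows "prime_components (poly_ring n) (edge_ideal n H :: 'a::field mpolynomial set) =
    var_ideal n ` min_covers n H"
proof -
  let ?R = "poly_ring n :: 'a mpolynomial ring"
  interpret cring ?R by (rule poly_ring_cring)
  show ?thesis
  proof (rule prime_components_eqI)
    show "finite (var_ideal n ` min_covers n H :: 'a mpolynomial set set)"
      using finite_covers by (simp add: min_covers_def)
    show "carrier ?R \<inter> \<Inter>(var_ideal n ` min_covers n H) = edge_ideal n H"
      by (rule edge_ideal_decomposition[OF H])
    fix P :: "'a mpolynomial set"
    assume "P \<in> var_ideal n ` min_covers n H"
    then obtain C where C: "C \<in> min_covers n H" "P = var_ideal n C" by blast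
    show "primeideal P ?R" unfolding C(2) by (rule primeideal_var_ideal)
    let ?x = "Poly_Mapping.single (sf_mon ({1..n} - C)) (1::'a)"
    have x_iff: "?x \<in> var_ideal n D \<longleftrightarrow> D \<inter> ({1..n} - C) \<noteq> {}" for D
      by (auto simp: var_ideal_def single_in_monomial_ideal_iff keys_sf_mon)
    have "?x \<in> var_ideal n D" if "D \<in> min_covers n H" "D \<noteq> C" for D
    proof -
      have "D \<subseteq> {1..n}" "\<not> D \<subseteq> C"
        using that C by (auto simp: min_covers_def covers_def)
      then show ?thesis unfolding x_iff by blast
    qed
    then have "?x \<in> \<Inter>(var_ideal n ` min_covers n H - {P})"
      using C by blast
    moreover have "?x \<in> carrier ?R"
      by (simp add: single_in_monomial_ideal_iff keys_sf_mon)
    moreover have "?x \<notin> P" unfolding C(2) x_iff by blast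
    moreover have "edge_ideal n H \<subseteq> P"
      unfolding edge_ideal_decomposition[OF H, symmetric] using C by blast
    ultimately show "carrier ?R \<inter> \<Inter>(var_ideal n ` min_covers n H - {P}) \<noteq> edge_ideal n H"
      by blast
  qed
qed

text \<open>
  The exponents of the \<open>q\<close>-th symbolic power. Asking for weight \<open>q\<close> on all covers instead of the minimal
  ones gives the same set, since weights are nonnegative, and allows non-minimal covers to be used
  in estimates.
\<close>

definition cover_weights :: "nat \<Rightarrow> nat set set \<Rightarrow> nat \<Rightarrow> (nat \<Rightarrow>\<^sub>0 nat) set"
  where "cover_weights n H q = {u. \<forall>C\<in>covers n H. q \<le> (\<Sum>j\<in>C. Poly_Mapping.lookup u j)}"

lemma symbolic_power_edge_ideal:
  assumes "H \<subseteq> Pow {1..n}"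
  shows "symbolic_power (poly_ring n) (edge_ideal n H) q =
    (monomial_ideal n (cover_weights n H q) :: 'a::field mpolynomial set)"
proof -
  let ?W = "\<lambda>C. {u. q \<le> (\<Sum>j\<in>C. Poly_Mapping.lookup u j)} :: (nat \<Rightarrow>\<^sub>0 nat) set"
  have fin: "finite C" if "C \<in> covers n H" for C
    using that finite_subset by (auto simp: covers_def)
  then have "symbolic_power (poly_ring n) (edge_ideal n H) q =
      carrier (poly_ring n) \<inter> (\<Inter>C\<in>min_covers n H. monomial_ideal n (?W C) :: 'a mpolynomial set)"
    unfolding symbolic_power_def prime_components_edge_ideal[OF assms]
    by (simp add: var_ideal_power min_covers_def)
  also have "\<dots> = monomial_ideal n (\<Inter>C\<in>min_covers n H. ?W C)"
    by (rule monomial_ideal_INT)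
  also have "(\<Inter>C\<in>min_covers n H. ?W C) = cover_weights n H q"
  proof
    show "cover_weights n H q \<subseteq> (\<Inter>C\<in>min_covers n H. ?W C)"
      by (auto simp: cover_weights_def min_covers_def)
    show "(\<Inter>C\<in>min_covers n H. ?W C) \<subseteq> cover_weights n H q"
    proof
      fix u assume u: "u \<in> (\<Inter>C\<in>min_covers n H. ?W C)"
      have "q \<le> (\<Sum>j\<in>C. Poly_Mapping.lookup u j)" if C: "C \<in> covers n H" for C
      proof -
        obtain D where D: "D \<in> min_covers n H" "D \<subseteq> C"
          using cover_contains_min_cover[OF C] .
        then have "q \<le> (\<Sum>j\<in>D. Poly_Mapping.lookup u j)" using u by blast
        also have "\<dots> \<le> (\<Sum>j\<in>C. Poly_Mapping.lookup u j)"
          using D fin[OF C] by (intro sum_mono2) auto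
        finally show ?thesis .
      qed
      then show "u \<in> cover_weights n H q" by (simp add: cover_weights_def)
    qed
  qed
  finally show ?thesis .
qed


section \<open>The Waldschmidt constant as a limit\<close>

text \<open>
  Fekete's lemma: the limit is the infimum of the quotients. If \<open>a p / p\<close> is close to
  the infimum, division of \<open>q\<close> by \<open>p\<close> with remainder gives \<open>a q / q \<le> a p / p + M / q\<close>,
  where \<open>M\<close> is any bound for \<open>a\<close> on the remainders.
\<close>

lemma fekete_nat:
  fixes a :: "nat \<Rightarrow> nat"
  assumes sub: "\<And>p q. a (p + q) \<le> a p + a q"
  obtains l where "(\<lambda>q. real (a q) / real q) \<longlonglongrightarrow> l" and "\<And>q. q \<ge> 1 \<Longrightarrow> l \<le> real (a q) / real q"
proof -
  define X where "X = (\<lambda>q. real (a q) / real q) ` {1..}"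
  have bdd: "bdd_below X" unfolding X_def by (intro bdd_belowI[of _ 0]) auto
  have le: "Inf X \<le> real (a q) / real q" if "q \<ge> 1" for q
    using bdd that by (intro cInf_lower) (auto simp: X_def)
  have mult: "a (k * p + r) \<le> k * a p + a r" for k p r
  proof (induction k)
    case (Suc k)
    have "a (Suc k * p + r) \<le> a p + a (k * p + r)"
      using sub[of p "k * p + r"] by (simp add: add.assoc)
    with Suc show ?case by simp
  qed simp
  have "(\<lambda>q. real (a q) / real q) \<longlonglongrightarrow> Inf X"
  proof (rule LIMSEQ_I)
    fix \<epsilon> :: real assume \<epsilon>: "\<epsilon> > 0"
    have "X \<noteq> {}" by (simp add: X_def)
    then obtain x where "x \<in> X" "x < Inf X + \<epsilon> / 2"
      using cInf_lessD[of X "Inf X + \<epsilon> / 2"] \<epsilon> by auto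
    then obtain p where p: "p \<ge> 1" "real (a p) / real p < Inf X + \<epsilon> / 2"
      by (auto simp: X_def)
    define M where "M = (\<Sum>r<p. a r)"
    have upper: "real (a q) / real q \<le> real (a p) / real p + real M / real q" if q: "q \<ge> 1" for q
    proof -
      have "a (q mod p) \<le> M"
        unfolding M_def using p by (intro member_le_sum) auto
      then have "a q \<le> (q div p) * a p + M"
        using mult[of "q div p" p "q mod p"] by simp
      then have "real (a q) \<le> real (q div p) * real (a p) + real M"
        by (metis of_nat_add of_nat_le_iff of_nat_mult)
      also have "\<dots> \<le> (real q / real p) * real (a p) + real M"
        using of_nat_div_le_of_nat[of q p, where ?'a=real] by (intro add_right_mono mult_right_mono) auto
      finally have "real (a q) / real q \<le> ((real q / real p) * real (a p) + real M) / real q"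
        by (intro divide_right_mono) auto
      also have "\<dots> = real (a p) / real p + real M / real q"
        using q by (simp add: field_simps)
      finally show ?thesis .
    qed
    obtain N :: nat where N: "real N > 2 * real M / \<epsilon>" using reals_Archimedean2 by blast
    show "\<exists>no. \<forall>q\<ge>no. norm (real (a q) / real q - Inf X) < \<epsilon>"
    proof (intro exI[of _ "Suc N"] allI impI)
      fix q assume q: "q \<ge> Suc N"
      then have "2 * real M / \<epsilon> < real q" using N by linarith
      then have "real M / real q < \<epsilon> / 2"
        using q \<epsilon> by (simp add: field_simps)
      then have "real (a q) / real q < Inf X + \<epsilon>"
        using upper[of q] p q by linarith
      then show "norm (real (a q) / real q - Inf X) < \<epsilon>"
        using le[of q] q \<epsilon> by (simp add: abs_if)
    qed
  qed
  then show ?thesis using le that by blast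
qed

text \<open>
  Exponent vectors with weight \<open>p\<close> and \<open>q\<close> on every cover add up to one with weight \<open>p + q\<close>, which gives
  subadditivity. A nonempty \<open>H\<close> makes every cover nonempty, so that the constant vector \<open>q\<close> is
  admissible and the least degrees are attained.
\<close>

lemma waldschmidt_edge_ideal_limit:
  fixes H :: "nat set set"
  assumes "H \<subseteq> Pow {1..n}" and "H \<noteq> {}"
  defines "deg_set \<equiv> \<lambda>q. mon_deg ` {u \<in> cover_weights n H q. Poly_Mapping.keys u \<subseteq> {1..n}}"
  defines "a \<equiv> \<lambda>q. LEAST d. d \<in> deg_set q"
  defines "w \<equiv> waldschmidt n (edge_ideal n H :: 'a::field mpolynomial set)"
  shows "(\<lambda>q. real (a q) / real q) \<longlonglongrightarrow> w" and "\<And>q. q \<ge> 1 \<Longrightarrow> w \<le> real (a q) / real q"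
    and "\<And>q. a q \<in> deg_set q" and "\<And>q d. d \<in> deg_set q \<Longrightarrow> a q \<le> d"
proof -
  have alpha: "alpha n (symbolic_power (poly_ring n) (edge_ideal n H :: 'a mpolynomial set) q) = a q"
    for q
    unfolding symbolic_power_edge_ideal[OF assms(1)] cover_weights_def a_def deg_set_def
    by (subst alpha_monomial_ideal[OF mult_closed_weight])
      (auto simp: cover_weights_def intro!: arg_cong[where f = Least])
  show least: "a q \<le> d" if "d \<in> deg_set q" for q d
    unfolding a_def using that by (rule Least_le)
  have "deg_set q \<noteq> {}" for q
  proof -
    define u where "u = (\<Sum>j=1..n. Poly_Mapping.single j q)"
    have l: "Poly_Mapping.lookup u j = (if j \<in> {1..n} then q else 0)" for j
      by (simp add: u_def lookup_sum lookup_single when_def)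
    have "q \<le> (\<Sum>j\<in>C. Poly_Mapping.lookup u j)" if C: "C \<in> covers n H" for C
    proof -
      obtain j where "j \<in> C" using C assms(2) by (auto simp: covers_def)
      moreover have "C \<subseteq> {1..n}" using C by (simp add: covers_def)
      ultimately have "q = Poly_Mapping.lookup u j" and "finite C"
        using l[of j] finite_subset[of C "{1..n}"] by auto
      then show ?thesis
        using \<open>j \<in> C\<close> by (simp add: member_le_sum)
    qed
    moreover have "Poly_Mapping.keys u \<subseteq> {1..n}" by (auto simp: in_keys_iff l split: if_splits)
    ultimately show ?thesis by (auto simp: deg_set_def cover_weights_def)
  qed
  then show mem: "a q \<in> deg_set q" for q
    unfolding a_def by (metis LeastI ex_in_conv)
  have "a (p + q) \<le> a p + a q" for p q
  proof -
    obtain u v where u: "u \<in> cover_weights n H p" "Poly_Mapping.keys u \<subseteq> {1..n}" "mon_deg u = a p"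
      and v: "v \<in> cover_weights n H q" "Poly_Mapping.keys v \<subseteq> {1..n}" "mon_deg v = a q"
      using mem[of p] mem[of q] by (auto simp: deg_set_def)
    have k: "Poly_Mapping.keys (u + v) \<subseteq> {1..n}" using u v by (simp add: keys_plus_nat)
    then have "mon_deg (u + v) = a p + a q"
      using u v by (simp add: mon_deg_eq_sum lookup_add sum.distrib)
    moreover have "u + v \<in> cover_weights n H (p + q)"
      using u(1) v(1) by (auto simp: cover_weights_def lookup_add sum.distrib intro: add_mono)
    ultimately show ?thesis
      using k by (intro least) (auto simp: deg_set_def intro!: image_eqI[of _ _ "u + v"])
  qed
  then obtain l where l: "(\<lambda>q. real (a q) / real q) \<longlonglongrightarrow> l"
    and le: "\<And>q. q \<ge> 1 \<Longrightarrow> l \<le> real (a q) / real q"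
    using fekete_nat by blast
  have "w = l"
    unfolding w_def waldschmidt_def alpha using l by (rule limI)
  then show "(\<lambda>q. real (a q) / real q) \<longlonglongrightarrow> w" "\<And>q. q \<ge> 1 \<Longrightarrow> w \<le> real (a q) / real q"
    using l le by simp_all
qed

lemma waldschmidt_edge_ideal_le:
  assumes "H \<subseteq> Pow {1..n}" and "H \<noteq> {}" and "q \<ge> 1"
    and "u \<in> cover_weights n H q" and "Poly_Mapping.keys u \<subseteq> {1..n}"
  shows "waldschmidt n (edge_ideal n H :: 'a::field mpolynomial set) \<le> real (mon_deg u) / real q"
proof -
  note lim = waldschmidt_edge_ideal_limit[OF assms(1,2)]
  have "mon_deg u \<in> mon_deg ` {u \<in> cover_weights n H q. Poly_Mapping.keys u \<subseteq> {1..n}}"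
    using assms by blast
  from lim(4)[OF this] show ?thesis
    by (intro order.trans[OF lim(2)[OF assms(3)]] divide_right_mono) auto
qed

lemma waldschmidt_edge_ideal_ge:
  assumes "H \<subseteq> Pow {1..n}" and "H \<noteq> {}"
    and "\<And>q u. u \<in> cover_weights n H q \<Longrightarrow> Poly_Mapping.keys u \<subseteq> {1..n} \<Longrightarrow>
      c * real q \<le> real (mon_deg u)"
  shows "c \<le> waldschmidt n (edge_ideal n H :: 'a::field mpolynomial set)"
proof (rule LIMSEQ_le_const)
  note lim = waldschmidt_edge_ideal_limit[OF assms(1,2)]
  let ?a = "\<lambda>q. LEAST d. d \<in> mon_deg ` {u \<in> cover_weights n H q. Poly_Mapping.keys u \<subseteq> {1..n}}"
  show "(\<lambda>q. real (?a q) / real q) \<longlonglongrightarrow> waldschmidt n (edge_ideal n H :: 'a mpolynomial set)"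
    by (rule lim(1))
  have "c \<le> real (?a q) / real q" if "q \<ge> 1" for q
    using lim(3)[of q] assms(3)[of _ q] that by (auto simp: field_simps)
  then show "\<exists>N. \<forall>q\<ge>N. c \<le> real (?a q) / real q" by blast
qed


section \<open>Square-free lex-segment ideals as edge ideals\<close>

text \<open>
  The supports of the generators of the square-free lex-segment ideal of the monomial \<open>sf_mon M\<close>.
\<close>

definition lex_edges :: "nat \<Rightarrow> nat set \<Rightarrow> nat set set"
  where "lex_edges n M = {e. e \<subseteq> {1..n} \<and> card e = card M \<and> sf_mon M \<le> sf_mon e}"

lemma finite_lex_edge: "e \<in> lex_edges n M \<Longrightarrow> finite e"
  using finite_subset by (auto simp: lex_edges_def)

lemma sf_lex_eq_edge_ideal:
  assumes "finite M"
  shows "sf_lex n (sf_mon M) = (edge_ideal n (lex_edges n M) :: 'a::field mpolynomial set)"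
proof -
  let ?B = "{u. Poly_Mapping.keys u \<subseteq> {1..n} \<and> squarefree_mon u \<and>
    mon_deg u = mon_deg (sf_mon M) \<and> sf_mon M \<le> u}"
  have "?B = sf_mon ` lex_edges n M"
  proof
    show "?B \<subseteq> sf_mon ` lex_edges n M"
    proof
      fix u assume u: "u \<in> ?B"
      then have eq: "u = sf_mon (Poly_Mapping.keys u)" by (intro squarefree_eq_sf_mon) simp
      then have "mon_deg u = card (Poly_Mapping.keys u)"
        by (metis mon_deg_sf_mon finite_keys)
      then have "Poly_Mapping.keys u \<in> lex_edges n M"
        using u assms eq by (simp add: lex_edges_def mon_deg_sf_mon)
      then show "u \<in> sf_mon ` lex_edges n M" using eq by blast
    qed
    show "sf_mon ` lex_edges n M \<subseteq> ?B"
    proof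
      fix u assume "u \<in> sf_mon ` lex_edges n M"
      then obtain e where e: "e \<in> lex_edges n M" "u = sf_mon e" by blast
      then have "finite e" using finite_lex_edge by blast
      then show "u \<in> ?B"
        using e assms by (simp add: lex_edges_def keys_sf_mon squarefree_sf_mon mon_deg_sf_mon)
    qed
  qed
  then have "sf_lex n (sf_mon M) =
      Idl\<^bsub>poly_ring n\<^esub> {Poly_Mapping.single u (1::'a) | u. u \<in> sf_mon ` lex_edges n M}"
    unfolding sf_lex_def by (intro arg_cong[where f = "genideal _"]) blast
  also have "\<dots> = monomial_ideal n {u. \<exists>b\<in>sf_mon ` lex_edges n M. \<exists>v. u = b + v}"
  proof (rule Idl_monomials)
    fix b assume "b \<in> sf_mon ` lex_edges n M"
    then show "Poly_Mapping.keys b \<subseteq> {1..n}"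
      by (auto simp: finite_lex_edge keys_sf_mon) (auto simp: lex_edges_def)
  qed
  also have "\<dots> = edge_ideal n (lex_edges n M)"
    unfolding edge_ideal_def
  proof (rule monomial_ideal_cong)
    fix u :: "nat \<Rightarrow>\<^sub>0 nat"
    have "(\<exists>v. u = sf_mon e + v) \<longleftrightarrow> e \<subseteq> Poly_Mapping.keys u" if "e \<in> lex_edges n M" for e
      using finite_lex_edge[OF that] by (rule sf_mon_divides_iff)
    then show "u \<in> {u. \<exists>b\<in>sf_mon ` lex_edges n M. \<exists>v. u = b + v} \<longleftrightarrow>
        u \<in> {u. \<exists>e\<in>lex_edges n M. e \<subseteq> Poly_Mapping.keys u}" by auto
  qed
  finally show ?thesis .
qed

lemma sf_mon_less:
  assumes "finite M" "finite e" and "k \<in> e" "k \<notin> M" and "\<And>j. j < k \<Longrightarrow> j \<in> M \<longleftrightarrow> j \<in> e"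
  shows "sf_mon M < sf_mon e"
  unfolding lex_less_iff using assms by (intro exI[of _ k]) (simp add: lookup_sf_mon)

text \<open>
  A monomial without a variable among the first \<open>Min M\<close> ones is lexicographically smaller than
  the monomial of \<open>M\<close>, the first difference being at \<open>Min M\<close>.
\<close>

lemma initial_segment_covers_lex_edges:
  assumes M: "M \<subseteq> {1..n}" "M \<noteq> {}"
  shows "{1..Min M} \<in> covers n (lex_edges n M)"
proof -
  have fin: "finite M" using M finite_subset by blast
  then have min: "Min M \<in> M" using M by simp
  have "e \<inter> {1..Min M} \<noteq> {}" if e: "e \<in> lex_edges n M" for e
  proof
    assume disj: "e \<inter> {1..Min M} = {}"
    have e1: "e \<subseteq> {1..n}" "finite e" using e finite_lex_edge[OF e] by (auto simp: lex_edges_def)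
    have "j \<notin> e" if "j \<le> Min M" for j using disj e1(1) that by (auto simp: disjoint_iff subset_iff)
    moreover have "j \<notin> M" if "j < Min M" for j using Min_le[OF fin, of j] that by linarith
    ultimately have "sf_mon e < sf_mon M"
      using fin e1 min by (intro sf_mon_less[of _ _ "Min M"]) auto
    then show False using e by (auto simp: lex_edges_def dest: leD)
  qed
  moreover have "Min M \<le> n" using min M by auto
  ultimately show ?thesis by (simp add: covers_def)
qed

lemma complement_covers_lex_edges:
  assumes "finite E" and "card E < card M"
  shows "{1..n} - E \<in> covers n (lex_edges n M)"
proof -
  have "e \<inter> ({1..n} - E) \<noteq> {}" if e: "e \<in> lex_edges n M" for e
  proof
    assume "e \<inter> ({1..n} - E) = {}"
    then have "e \<subseteq> E" using e by (auto simp: lex_edges_def)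
    then have "card e \<le> card E" using assms(1) by (rule card_mono[rotated])
    then show False using e assms(2) by (simp add: lex_edges_def)
  qed
  then show ?thesis by (auto simp: covers_def)
qed

text \<open>
  Such a set \<open>U\<close> either has an element below \<open>Min M\<close>, which makes its monomial larger, or is contained in \<open>M\<close>
  and then equals \<open>M\<close> by cardinality.
\<close>

lemma subset_is_lex_edge:
  assumes M: "M \<subseteq> {1..n}" "M \<noteq> {}" and U: "U \<subseteq> {1..Min M} \<union> M" and card: "card U = card M"
  shows "U \<in> lex_edges n M"
proof -
  have finM: "finite M" using M finite_subset by blast
  then have min: "Min M \<in> M" and le: "\<And>j. j \<in> M \<Longrightarrow> Min M \<le> j" using M by auto
  have "Min M \<le> n" using min M by auto
  then have Un: "U \<subseteq> {1..n}" using U M by fastforce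
  then have finU: "finite U" using finite_subset by blast
  have "U \<noteq> {}" using card finM M by auto
  then have minU: "Min U \<in> U" and leU: "\<And>j. j \<in> U \<Longrightarrow> Min U \<le> j" using finU by auto
  have "sf_mon M \<le> sf_mon U"
  proof (cases "Min U < Min M")
    case True
    have "sf_mon M < sf_mon U"
      using finM finU minU
    proof (rule sf_mon_less)
      show "Min U \<notin> M" using True le by force
      show "j \<in> M \<longleftrightarrow> j \<in> U" if "j < Min U" for j
        using that True le[of j] leU[of j] by linarith
    qed
    then show ?thesis by simp
  next
    case False
    have "j \<in> M" if "j \<in> U" for j
    proof (cases "j = Min M")
      case False
      then have "\<not> j \<le> Min M" using \<open>\<not> Min U < Min M\<close> leU[OF that] by linarith
      then show ?thesis using U that by auto
    qed (simp add: min)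
    then have "U = M" using card finM by (intro card_subset_eq) auto
    then show ?thesis by simp
  qed
  then show ?thesis using Un card by (simp add: lex_edges_def)
qed


section \<open>The bounds\<close>

text \<open>
  Covers are compared with the set \<open>T = {1..Min M} \<union> M\<close>, all of whose subsets of size \<open>card M\<close> are
  edges: a cover leaves fewer than \<open>card M\<close> points of \<open>T\<close> uncovered.
\<close>

lemma waldschmidt_sf_lex_le:
  assumes M: "M \<subseteq> {1..n}" "M \<noteq> {}"
  shows "waldschmidt n (sf_lex n (sf_mon M) :: 'a::field mpolynomial set) \<le>
    1 + (real (card M) - 1) / real (Min M)"
proof -
  define a T where "a = Min M" and "T = {1..a} \<union> M"
  let ?H = "lex_edges n M"
  have finM: "finite M" using M finite_subset by blast
  then have min: "a \<in> M" and le: "\<And>j. j \<in> M \<Longrightarrow> a \<le> j" using M by (auto simp: a_def)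
  have a: "1 \<le> a" "a \<le> n" using min M by auto
  have finT: "finite T" and Tn: "T \<subseteq> {1..n}"
    using finM a M by (auto simp: T_def)
  have "{1..a} \<inter> M = {a}" using a min le by force
  then have cardT: "card T + 1 = a + card M"
    using card_Un_Int[of "{1..a}" M] finM by (simp add: T_def)
  have weight: "(\<Sum>j\<in>C. Poly_Mapping.lookup (sf_mon T) j) = card (C \<inter> T)" if "finite C" for C
    using that finT by (simp add: lookup_sf_mon sum.If_cases Int_def)
  have "sf_mon T \<in> cover_weights n ?H a"
  proof -
    have "a \<le> card (C \<inter> T)" if C: "C \<in> covers n ?H" for C
    proof (rule ccontr)
      assume "\<not> a \<le> card (C \<inter> T)"
      moreover have "card T = card (C \<inter> T) + card (T - C)"
        using finT by (metis card_Int_Diff Int_commute)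
      ultimately have "card M \<le> card (T - C)" using cardT by linarith
      then obtain U where U: "U \<subseteq> T - C" "card U = card M"
        using obtain_subset_with_card_n by metis
      then have "U \<in> ?H"
        using M by (intro subset_is_lex_edge) (auto simp: T_def a_def)
      then show False using C U by (auto simp: covers_def)
    qed
    moreover have "finite C" if "C \<in> covers n ?H" for C
      using that finite_subset[of C "{1..n}"] by (simp add: covers_def)
    ultimately show ?thesis by (simp add: cover_weights_def weight)
  qed
  moreover have "M \<in> ?H" using M by (intro subset_is_lex_edge) auto
  then have "?H \<noteq> {}" by blast
  moreover have "?H \<subseteq> Pow {1..n}" by (auto simp: lex_edges_def)
  ultimately have "waldschmidt n (edge_ideal n ?H :: 'a mpolynomial set) \<le>
      real (mon_deg (sf_mon T)) / real a"
    using a Tn finT by (intro waldschmidt_edge_ideal_le) (simp_all add: keys_sf_mon)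
  also have "\<dots> = 1 + (real (card M) - 1) / real a"
  proof -
    have "real (card T) = real a + (real (card M) - 1)" using cardT by linarith
    then show ?thesis using a finT by (simp add: mon_deg_sf_mon add_divide_distrib)
  qed
  finally show ?thesis unfolding sf_lex_eq_edge_ideal[OF finM] a_def .
qed

lemma exists_heaviest_subset:
  fixes y :: "'b \<Rightarrow> nat"
  assumes "finite X" and "k \<le> card X"
  shows "\<exists>E\<subseteq>X. card E = k \<and> (\<forall>e\<in>E. \<forall>x\<in>X - E. y x \<le> y e)"
  using assms(2)
proof (induction k)
  case 0
  show ?case by (intro exI[of _ "{}"]) simp
next
  case (Suc k)
  then obtain E where E: "E \<subseteq> X" "card E = k" "\<forall>e\<in>E. \<forall>x\<in>X - E. y x \<le> y e" by auto
  have finE: "finite E" using E(1) assms(1) by (rule finite_subset)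
  have "X - E \<noteq> {}" using Suc.prems E(2) card_mono[OF finE, of X] by auto
  then have "Max (y ` (X - E)) \<in> y ` (X - E)" using assms(1) by (intro Max_in) auto
  then obtain x where x: "x \<in> X - E" "y x = Max (y ` (X - E))" by auto
  have max: "y z \<le> y x" if "z \<in> X - E" for z
    unfolding x(2) using that assms(1) by (intro Max_ge) auto
  have "card (insert x E) = Suc k" using x E finE by simp
  moreover have "\<forall>e\<in>insert x E. \<forall>z\<in>X - insert x E. y z \<le> y e"
    using E(3) max by blast
  ultimately show ?case using E(1) x by (intro exI[of _ "insert x E"]) blast
qed

text \<open>
  The \<open>k\<close> heaviest points have at least the average weight of the others. Multiplying out the
  averages avoids division and covers the cases in which one of the two sets is empty.
\<close>

lemma heavy_subset:
  fixes y :: "'b \<Rightarrow> nat"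
  assumes "finite X" and "k \<le> card X"
  obtains E where "E \<subseteq> X" "card E = k"
    and "k * (\<Sum>x\<in>X - E. y x) \<le> (card X - k) * (\<Sum>x\<in>E. y x)"
proof -
  obtain E where E: "E \<subseteq> X" "card E = k" and dom: "\<forall>e\<in>E. \<forall>x\<in>X - E. y x \<le> y e"
    using exists_heaviest_subset[OF assms] by blast
  have "k * (\<Sum>x\<in>X - E. y x) = (\<Sum>e\<in>E. \<Sum>x\<in>X - E. y x)" using E by simp
  also have "\<dots> \<le> (\<Sum>e\<in>E. \<Sum>x\<in>X - E. y e)" using dom by (intro sum_mono) blast
  also have "\<dots> = card (X - E) * (\<Sum>e\<in>E. y e)" by (simp add: sum_distrib_left)
  also have "card (X - E) = card X - k"
    using E finite_subset[OF E(1) assms(1)] by (simp add: card_Diff_subset)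
  finally show ?thesis using that E by blast
qed

text \<open>
  The two families of covers behind both lower bounds, the second stated as a gain of \<open>q\<close> over
  the weight of the complement \<open>E\<close> of the cover.
\<close>

lemma cover_weights_lex_edges:
  assumes M: "M \<subseteq> {1..n}" "M \<noteq> {}"
    and u: "u \<in> cover_weights n (lex_edges n M) q" "Poly_Mapping.keys u \<subseteq> {1..n}"
  shows "q \<le> (\<Sum>j=1..Min M. Poly_Mapping.lookup u j)"
    and "E \<subseteq> {1..n} \<Longrightarrow> card E < card M \<Longrightarrow>
      q + (\<Sum>j\<in>E. Poly_Mapping.lookup u j) \<le> mon_deg u"
proof -
  show "q \<le> (\<Sum>j=1..Min M. Poly_Mapping.lookup u j)"
    using initial_segment_covers_lex_edges[OF M] u(1) by (auto simp: cover_weights_def)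
  assume E: "E \<subseteq> {1..n}" "card E < card M"
  then have "q \<le> (\<Sum>j\<in>{1..n} - E. Poly_Mapping.lookup u j)"
    using complement_covers_lex_edges[of E M n] u(1) finite_subset[OF E(1)]
    by (auto simp: cover_weights_def)
  also have "\<dots> + (\<Sum>j\<in>E. Poly_Mapping.lookup u j) = mon_deg u"
    unfolding mon_deg_eq_sum[OF u(2)] using E by (simp add: sum.subset_diff[of E])
  finally show "q + (\<Sum>j\<in>E. Poly_Mapping.lookup u j) \<le> mon_deg u" by simp
qed

lemma waldschmidt_sf_lex_geI:
  assumes M: "M \<subseteq> {1..n}" "M \<noteq> {}"
    and "\<And>q u. u \<in> cover_weights n (lex_edges n M) q \<Longrightarrow> Poly_Mapping.keys u \<subseteq> {1..n} \<Longrightarrow>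
      c * real q \<le> real (mon_deg u)"
  shows "c \<le> waldschmidt n (sf_lex n (sf_mon M) :: 'a::field mpolynomial set)"
proof -
  have "M \<in> lex_edges n M" using M by (intro subset_is_lex_edge) auto
  then have nonempty: "lex_edges n M \<noteq> {}" by blast
  have sub: "lex_edges n M \<subseteq> Pow {1..n}" by (auto simp: lex_edges_def)
  have "finite M" using M finite_subset by blast
  show ?thesis
    unfolding sf_lex_eq_edge_ideal[OF \<open>finite M\<close>]
    using assms(3) by (rule waldschmidt_edge_ideal_ge[OF sub nonempty])
qed

text \<open>
  Here \<open>E\<close> consists of the \<open>k = card M - 1\<close> heaviest points of \<open>{1..a}\<close>. Their share of the weight of
  \<open>{1..a}\<close>, which is at least \<open>q\<close>, is at least \<open>k / a\<close>.
\<close>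

lemma waldschmidt_sf_lex_ge_large_min:
  assumes M: "M \<subseteq> {1..n}" "M \<noteq> {}" and large: "card M \<le> Min M + 1"
  shows "1 + (real (card M) - 1) / real (Min M) \<le>
    waldschmidt n (sf_lex n (sf_mon M) :: 'a::field mpolynomial set)"
proof (rule waldschmidt_sf_lex_geI[OF M])
  fix q u
  assume u: "u \<in> cover_weights n (lex_edges n M) q" "Poly_Mapping.keys u \<subseteq> {1..n}"
  define a k where "a = Min M" and "k = card M - 1"
  have finM: "finite M" using M finite_subset by blast
  have cardM: "card M = k + 1" using finM M by (simp add: k_def card_gt_0_iff Suc_leI)
  have "a \<in> M" using finM M by (simp add: a_def)
  then have a: "1 \<le> a" "a \<le> n" using M by auto
  let ?y = "Poly_Mapping.lookup u"
  have ka: "k \<le> a" using large cardM by (simp add: a_def)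
  obtain E where E: "E \<subseteq> {1..a}" "card E = k"
    and heavy: "k * (\<Sum>j\<in>{1..a} - E. ?y j) \<le> (a - k) * (\<Sum>j\<in>E. ?y j)"
    using heavy_subset[of "{1..a}" k ?y] ka by auto
  have "k * q \<le> k * (\<Sum>j=1..a. ?y j)"
    using cover_weights_lex_edges(1)[OF M u] by (simp add: a_def)
  also have "\<dots> = k * (\<Sum>j\<in>{1..a} - E. ?y j) + k * (\<Sum>j\<in>E. ?y j)"
    using E by (simp add: sum.subset_diff[of E] add_mult_distrib2)
  also have "\<dots> \<le> ((a - k) + k) * (\<Sum>j\<in>E. ?y j)"
    using heavy by (simp only: add_mult_distrib)
  also have "\<dots> = a * (\<Sum>j\<in>E. ?y j)" using ka by simp
  finally have "real k * real q \<le> real a * real (\<Sum>j\<in>E. ?y j)"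
    by (metis of_nat_le_iff of_nat_mult)
  then have "real k / real a * real q \<le> real (\<Sum>j\<in>E. ?y j)"
    using a by (simp add: field_simps)
  moreover have "real q + real (\<Sum>j\<in>E. ?y j) \<le> real (mon_deg u)"
    using cover_weights_lex_edges(2)[OF M u, of E] E a cardM
    by (metis of_nat_add of_nat_le_iff less_add_one atLeastatMost_subset_iff order_refl subset_trans)
  ultimately have "(1 + real k / real a) * real q \<le> real (mon_deg u)"
    by (simp add: algebra_simps)
  then show "(1 + (real (card M) - 1) / real (Min M)) * real q \<le> real (mon_deg u)"
    by (simp add: cardM a_def)
qed

text \<open>
  Now \<open>{1..a}\<close> fits into \<open>E\<close> and contributes \<open>q\<close>; the complement of \<open>E\<close> contributes another \<open>q\<close>. The room
  left in \<open>E\<close> is filled with the \<open>k\<close> heaviest points beyond \<open>a\<close>: the \<open>r = n - card M + 1\<close> points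
  outside \<open>E\<close> carry weight at least \<open>q\<close>, so these \<open>k\<close> points carry at least \<open>k q / r\<close>.
\<close>

lemma waldschmidt_sf_lex_ge_small_min:
  assumes M: "M \<subseteq> {1..n}" "M \<noteq> {}" and small: "Min M + 1 \<le> card M"
  shows "2 + (real (card M) - real (Min M) - 1) / (real n - real (card M) + 1) \<le>
    waldschmidt n (sf_lex n (sf_mon M) :: 'a::field mpolynomial set)"
proof (rule waldschmidt_sf_lex_geI[OF M])
  fix q u
  assume u: "u \<in> cover_weights n (lex_edges n M) q" "Poly_Mapping.keys u \<subseteq> {1..n}"
  define a k r where "a = Min M" and "k = card M - 1 - a" and "r = n + 1 - card M"
  have finM: "finite M" using M finite_subset by blast
  have min: "a \<in> M" and "\<And>j. j \<in> M \<Longrightarrow> a \<le> j" using finM M by (auto simp: a_def)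
  then have "M \<subseteq> {a..n}" using M by auto
  then have "card M \<le> n + 1 - a" using card_mono[of "{a..n}" M] by simp
  moreover have a: "1 \<le> a" "a \<le> n" using min M by auto
  ultimately have card: "card M = k + a + 1" "n - a = k + r" "1 \<le> r"
    "real n - real (card M) + 1 = real r"
    using small by (auto simp: k_def r_def a_def)
  let ?y = "Poly_Mapping.lookup u"
  let ?X = "{a<..n}"
  obtain F where F: "F \<subseteq> ?X" "card F = k"
    and heavy: "k * (\<Sum>j\<in>?X - F. ?y j) \<le> (card ?X - k) * (\<Sum>j\<in>F. ?y j)"
    using heavy_subset[of ?X k ?y] card by auto
  let ?E = "{1..a} \<union> F"
  have finF: "finite F" using F(1) finite_subset by blast
  have disj: "{1..a} \<inter> F = {}" using F(1) by auto
  have E: "?E \<subseteq> {1..n}" using F(1) a by auto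
  have "card ?E < card M"
    using finF disj F card by (simp add: card_Un_disjoint)
  then have total: "q + (\<Sum>j\<in>?E. ?y j) \<le> mon_deg u"
    by (rule cover_weights_lex_edges(2)[OF M u E])
  have E_sum: "(\<Sum>j\<in>?E. ?y j) = (\<Sum>j=1..a. ?y j) + (\<Sum>j\<in>F. ?y j)"
    using finF disj by (simp add: sum.union_disjoint)
  have first: "q \<le> (\<Sum>j=1..a. ?y j)"
    using cover_weights_lex_edges(1)[OF M u] by (simp add: a_def)
  have "{1..n} = ?E \<union> (?X - F)" using F(1) a by auto
  then have "mon_deg u = (\<Sum>j\<in>?E. ?y j) + (\<Sum>j\<in>?X - F. ?y j)"
    unfolding mon_deg_eq_sum[OF u(2)] using finF
    by (simp only:) (subst sum.union_disjoint; auto)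
  then have "k * q \<le> k * (\<Sum>j\<in>?X - F. ?y j)" using total by simp
  also have "\<dots> \<le> r * (\<Sum>j\<in>F. ?y j)" using heavy card by simp
  finally have "real k * real q \<le> real r * real (\<Sum>j\<in>F. ?y j)"
    by (metis of_nat_le_iff of_nat_mult)
  then have "real k / real r * real q \<le> real (\<Sum>j\<in>F. ?y j)"
    using card(3) by (simp add: field_simps)
  moreover have "2 * real q + real (\<Sum>j\<in>F. ?y j) \<le> real (mon_deg u)"
    using total E_sum first by linarith
  ultimately have "(2 + real k / real r) * real q \<le> real (mon_deg u)"
    by (simp add: algebra_simps)
  then show "(2 + (real (card M) - real (Min M) - 1) / (real n - real (card M) + 1)) * real q
      \<le> real (mon_deg u)"
    unfolding card(4) by (simp add: card(1) flip: a_def)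
qed

theorem theorem6p3:
  fixes n s :: nat and i :: "nat \<Rightarrow> nat" and m :: "nat \<Rightarrow>\<^sub>0 nat"
    and L :: "'a::field mpolynomial set"
  assumes "1 \<le> s" and "1 \<le> i 1" and "strict_mono_on {1..s} i" and "i s \<le> n"
    and "m = (\<Sum>k=1..s. Poly_Mapping.single (i k) 1)"
    and "L = sf_lex n m"
  shows "waldschmidt n L \<le> 1 + (real s - 1) / real (i 1)
    \<and> waldschmidt n L \<ge>
        (if i 1 \<ge> s then 1 + (real s - 1) / real (i 1)
         else 2 + (real s - real (i 1) - 1) / (real n - real s + 1))
    \<and> (real (i 1) \<ge> real s - 1 \<longrightarrow> waldschmidt n L = 1 + (real s - 1) / real (i 1))"
proof -
  define M where "M = i ` {1..s}"
  have inj: "inj_on i {1..s}" using assms(3) by (rule strict_mono_on_imp_inj_on)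
  have mono: "i j \<le> i k" if "j \<in> {1..s}" "k \<in> {1..s}" "j \<le> k" for j k
    using strict_mono_on_leD[OF assms(3)] that by blast
  have L: "L = sf_lex n (sf_mon M)"
    unfolding assms(5,6) M_def sf_mon_def using inj by (simp add: sum.reindex)
  have M: "M \<subseteq> {1..n}" "M \<noteq> {}"
    using mono[of 1] mono[of _ s] assms(1,2,4) by (fastforce simp: M_def)+
  have card: "card M = s" using inj by (simp add: M_def card_image)
  have min: "Min M = i 1"
    using mono[of 1] assms(1) by (intro Min_eqI) (auto simp: M_def)
  have upper: "waldschmidt n L \<le> 1 + (real s - 1) / real (i 1)"
    using waldschmidt_sf_lex_le[OF M] by (simp add: L card min)
  have large: "1 + (real s - 1) / real (i 1) \<le> waldschmidt n L" if "s \<le> i 1 + 1"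
    using waldschmidt_sf_lex_ge_large_min[OF M] that by (simp add: L card min)
  have small: "2 + (real s - real (i 1) - 1) / (real n - real s + 1) \<le> waldschmidt n L"
    if "i 1 + 1 \<le> s"
    using waldschmidt_sf_lex_ge_small_min[OF M] that by (simp add: L card min)
  have "s \<le> i 1 + 1" if "real (i 1) \<ge> real s - 1" using that by linarith
  then show ?thesis using upper large small by (simp add: order_antisym)
qed

end
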